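(* There is a function $f\colon F_\omega\to F_2$ which is a consequence-respecting, tautology-respecting and $(\wedge,\vee)$-preserving translation of $\omega$-variable intuitionistic propositional logic into $2$-variable intuitionistic propositional logic.
   Context: $F_2$ is the set of propositional formulas in the variables $x_1,x_2$, and $F_\omega$ is the set of propositional formulas in the variables $x_1,x_2,\ldots$. Let $\vdash$ be the intuitionistic consequence relation. A function $f\colon F_\omega\to F_2$ is: consequence-respecting if for all $\Gamma\subseteq F_\omega$ with $\Gamma\neq\emptyset$ and all $\phi\in F_\omega$, $\Gamma\vdash\phi$ iff $f(\Gamma)\vdash f(\phi)$, where $f(\Gamma)=\{f(\gamma)\mid\gamma\in\Gamma\}$; tautology-respecting if for all $\phi\in F_\omega$, $\vdash\phi$ iff $\vdash f(\phi)$; $(\wedge,\vee)$-preserving if for all $\phi,\psi\in F_\omega$, $f(\phi\wedge\psi)=f(\phi)\wedge f(\psi)$ and $f(\phi\vee\psi)=f(\phi)\vee f(\psi)$. *)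

theory Defs
  imports Main
begin

text \<open>Negation, verum and equivalence are the usual abbreviations
  (\<open>\<phi> \<^bold>\<rightarrow> \<^bold>\<bottom>\<close>, \<open>\<^bold>\<bottom> \<^bold>\<rightarrow> \<^bold>\<bottom>\<close>, \<open>(\<phi> \<^bold>\<rightarrow> \<psi>) \<^bold>\<and> (\<psi> \<^bold>\<rightarrow> \<phi>)\<close>) and are not constructors.\<close>

datatype 'v form =
    Var 'v
  | Falsum  (\<open>\<^bold>\<bottom>\<close>)
  | Conj "'v form" "'v form"  (infixr \<open>\<^bold>\<and>\<close> 65)
  | Disj "'v form" "'v form"  (infixr \<open>\<^bold>\<or>\<close> 60)
  | Impl "'v form" "'v form"  (infixr \<open>\<^bold>\<rightarrow>\<close> 55)

datatype two = X1 | X2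

type_synonym F2 = "two form"

text \<open>The variable \<open>x\<^sub>n\<close> (\<open>n \<ge> 1\<close>) is \<open>Var (n - 1)\<close>.\<close>

type_synonym F\<omega> = "nat form"

text \<open>Natural deduction for intuitionistic logic. The set of premises may be infinite, and derivations
  stay inside the language with variables in \<open>'v\<close>.\<close>

inductive entails :: "'v form set \<Rightarrow> 'v form \<Rightarrow> bool"  (infix \<open>\<turnstile>\<close> 50) where
  Assm: "\<phi> \<in> \<Gamma> \<Longrightarrow> \<Gamma> \<turnstile> \<phi>"
| FalsumE: "\<Gamma> \<turnstile> \<^bold>\<bottom> \<Longrightarrow> \<Gamma> \<turnstile> \<phi>"
| ConjI: "\<Gamma> \<turnstile> \<phi> \<Longrightarrow> \<Gamma> \<turnstile> \<psi> \<Longrightarrow> \<Gamma> \<turnstile> \<phi> \<^bold>\<and> \<psi>"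
| ConjE1: "\<Gamma> \<turnstile> \<phi> \<^bold>\<and> \<psi> \<Longrightarrow> \<Gamma> \<turnstile> \<phi>"
| ConjE2: "\<Gamma> \<turnstile> \<phi> \<^bold>\<and> \<psi> \<Longrightarrow> \<Gamma> \<turnstile> \<psi>"
| DisjI1: "\<Gamma> \<turnstile> \<phi> \<Longrightarrow> \<Gamma> \<turnstile> \<phi> \<^bold>\<or> \<psi>"
| DisjI2: "\<Gamma> \<turnstile> \<psi> \<Longrightarrow> \<Gamma> \<turnstile> \<phi> \<^bold>\<or> \<psi>"
| DisjE: "\<Gamma> \<turnstile> \<phi> \<^bold>\<or> \<psi> \<Longrightarrow> insert \<phi> \<Gamma> \<turnstile> \<chi> \<Longrightarrow> insert \<psi> \<Gamma> \<turnstile> \<chi> \<Longrightarrow> \<Gamma> \<turnstile> \<chi>"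
| ImplI: "insert \<phi> \<Gamma> \<turnstile> \<psi> \<Longrightarrow> \<Gamma> \<turnstile> \<phi> \<^bold>\<rightarrow> \<psi>"
| ImplE: "\<Gamma> \<turnstile> \<phi> \<^bold>\<rightarrow> \<psi> \<Longrightarrow> \<Gamma> \<turnstile> \<phi> \<Longrightarrow> \<Gamma> \<turnstile> \<psi>"

definition consequence_respecting :: "(F\<omega> \<Rightarrow> F2) \<Rightarrow> bool" where
  "consequence_respecting f \<longleftrightarrow>
     (\<forall>\<Gamma> \<phi>. \<Gamma> \<noteq> {} \<longrightarrow> (\<Gamma> \<turnstile> \<phi> \<longleftrightarrow> f ` \<Gamma> \<turnstile> f \<phi>))"

definition tautology_respecting :: "(F\<omega> \<Rightarrow> F2) \<Rightarrow> bool" where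
  "tautology_respecting f \<longleftrightarrow> (\<forall>\<phi>. {} \<turnstile> \<phi> \<longleftrightarrow> {} \<turnstile> f \<phi>)"

definition conj_disj_preserving :: "(F\<omega> \<Rightarrow> F2) \<Rightarrow> bool" where
  "conj_disj_preserving f \<longleftrightarrow>
     (\<forall>\<phi> \<psi>. f (\<phi> \<^bold>\<and> \<psi>) = f \<phi> \<^bold>\<and> f \<psi> \<and> f (\<phi> \<^bold>\<or> \<psi>) = f \<phi> \<^bold>\<or> f \<psi>)"

end

theory Submission imports Defs begin

text \<open>
  The translation \<open>tr\<close> replaces \<open>\<^bold>\<bottom>\<close> by a formula \<open>\<alpha>\<^sub>0\<close> and each variable by
  \<open>\<alpha>\<^sub>n \<^bold>\<or> \<alpha>\<^sub>0\<close>, where \<open>\<alpha>\<^sub>0, \<alpha>\<^sub>1, \<dots>\<close> are two-variable formulas, and it commutes with all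
  three binary connectives. Since \<open>\<alpha>\<^sub>0\<close> entails every translated formula (\<open>tr_ex_falso\<close>), it
  plays the part of falsum and derivations are translated rule by rule (\<open>tr_entails\<close>).

  Conversely, a Kripke model of the original language has to be turned into a model in two
  variables that agrees with it through \<open>tr\<close>. The Rieger-Nishimura ladder provides infinitely many
  points that are told apart by formulas in \<open>x\<^sub>1\<close> alone (\<open>forces_rung_Ladder\<close>). Give the whole
  ladder \<open>x\<^sub>2\<close>, and hang below the \<open>k\<close>-th rung a twin of it, \<open>Side k\<close>, without \<open>x\<^sub>2\<close>. Then
  the formula \<open>miss k\<close> fails exactly at the points that see \<open>Side k\<close>, and the twins form an infinite
  antichain. An old world in which the \<open>i\<close>-th letter fails is made to see both \<open>Side (2 * i)\<close> and
  \<open>Side (2 * i + 1)\<close>, and \<open>\<alpha>\<^sub>i\<close> is \<open>miss (2 * i) \<^bold>\<or> miss (2 * i + 1)\<close>. Using two twins for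
  one letter is the point of the construction: no added point sees both of them, so all the
  \<open>\<alpha>\<^sub>i\<close>, and hence all translated formulas, hold at the added points. They therefore cannot disturb
  the evaluation of implications at old worlds (\<open>forces_tr\<close>). Applied to the canonical model of
  prime theories, this refutes \<open>tr \<phi>\<close> from \<open>tr ` \<Gamma>\<close> whenever \<open>\<Gamma>\<close> does not entail \<open>\<phi>\<close>.
\<close>

section \<open>Structural properties of derivations\<close>

lemma weakening: "\<Gamma> \<turnstile> \<phi> \<Longrightarrow> \<Gamma> \<subseteq> \<Delta> \<Longrightarrow> \<Delta> \<turnstile> \<phi>"
proof (induction arbitrary: \<Delta> rule: entails.induct)
  case (DisjE \<Gamma> \<phi> \<psi> \<chi>)
  then show ?case by (meson entails.DisjE insert_mono)
next
  case (ImplI \<phi> \<Gamma> \<psi>)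
  then show ?case by (meson entails.ImplI insert_mono)
qed (blast intro: entails.intros)+

lemma cut: "\<Gamma> \<turnstile> \<phi> \<Longrightarrow> insert \<phi> \<Gamma> \<turnstile> \<psi> \<Longrightarrow> \<Gamma> \<turnstile> \<psi>"
  by (blast intro: ImplI ImplE)

lemma finite_premises: "\<Gamma> \<turnstile> \<phi> \<Longrightarrow> \<exists>\<Delta>. finite \<Delta> \<and> \<Delta> \<subseteq> \<Gamma> \<and> \<Delta> \<turnstile> \<phi>"
proof (induction rule: entails.induct)
  case (Assm \<phi> \<Gamma>)
  then have "finite {\<phi>} \<and> {\<phi>} \<subseteq> \<Gamma> \<and> {\<phi>} \<turnstile> \<phi>" by (auto intro: entails.Assm)
  then show ?case by blast
next
  case (ConjI \<Gamma> \<phi> \<psi>)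
  then obtain \<Delta> \<Delta>' where "finite \<Delta>" "\<Delta> \<subseteq> \<Gamma>" "\<Delta> \<turnstile> \<phi>" "finite \<Delta>'" "\<Delta>' \<subseteq> \<Gamma>" "\<Delta>' \<turnstile> \<psi>" by blast
  then have "finite (\<Delta> \<union> \<Delta>') \<and> \<Delta> \<union> \<Delta>' \<subseteq> \<Gamma> \<and> \<Delta> \<union> \<Delta>' \<turnstile> \<phi> \<^bold>\<and> \<psi>"
    by (meson entails.ConjI finite_UnI le_sup_iff sup_ge1 sup_ge2 weakening)
  then show ?case by blast
next
  case (DisjE \<Gamma> \<phi> \<psi> \<chi>)
  then obtain \<Delta> \<Delta>1 \<Delta>2 where *: "finite \<Delta>" "\<Delta> \<subseteq> \<Gamma>" "\<Delta> \<turnstile> \<phi> \<^bold>\<or> \<psi>"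
    "finite \<Delta>1" "\<Delta>1 \<subseteq> insert \<phi> \<Gamma>" "\<Delta>1 \<turnstile> \<chi>" "finite \<Delta>2" "\<Delta>2 \<subseteq> insert \<psi> \<Gamma>" "\<Delta>2 \<turnstile> \<chi>" by blast
  let ?\<Delta> = "\<Delta> \<union> (\<Delta>1 - {\<phi>}) \<union> (\<Delta>2 - {\<psi>})"
  have "?\<Delta> \<turnstile> \<phi> \<^bold>\<or> \<psi>" using *(3) by (rule weakening) blast
  moreover have "insert \<phi> ?\<Delta> \<turnstile> \<chi>" using *(6) by (rule weakening) blast
  moreover have "insert \<psi> ?\<Delta> \<turnstile> \<chi>" using *(9) by (rule weakening) blast
  ultimately have "?\<Delta> \<turnstile> \<chi>" by (rule entails.DisjE)
  moreover have "finite ?\<Delta>" "?\<Delta> \<subseteq> \<Gamma>" using *(1,2,4,5,7,8) by auto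
  ultimately show ?case by (intro exI[of _ ?\<Delta>] conjI)
next
  case (ImplI \<phi> \<Gamma> \<psi>)
  then obtain \<Delta> where *: "finite \<Delta>" "\<Delta> \<subseteq> insert \<phi> \<Gamma>" "\<Delta> \<turnstile> \<psi>" by blast
  have "insert \<phi> (\<Delta> - {\<phi>}) \<turnstile> \<psi>" using *(3) by (rule weakening) blast
  then have "\<Delta> - {\<phi>} \<turnstile> \<phi> \<^bold>\<rightarrow> \<psi>" by (rule entails.ImplI)
  moreover have "finite (\<Delta> - {\<phi>})" "\<Delta> - {\<phi>} \<subseteq> \<Gamma>" using *(1,2) by auto
  ultimately show ?case by (intro exI[of _ "\<Delta> - {\<phi>}"] conjI)
next
  case (ImplE \<Gamma> \<phi> \<psi>)
  then obtain \<Delta> \<Delta>' where *: "finite \<Delta>" "\<Delta> \<subseteq> \<Gamma>" "\<Delta> \<turnstile> \<phi> \<^bold>\<rightarrow> \<psi>" "finite \<Delta>'" "\<Delta>' \<subseteq> \<Gamma>" "\<Delta>' \<turnstile> \<phi>"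
    by blast
  have "\<Delta> \<union> \<Delta>' \<turnstile> \<phi> \<^bold>\<rightarrow> \<psi>" using *(3) by (rule weakening) blast
  moreover have "\<Delta> \<union> \<Delta>' \<turnstile> \<phi>" using *(6) by (rule weakening) blast
  ultimately have "\<Delta> \<union> \<Delta>' \<turnstile> \<psi>" by (rule entails.ImplE)
  then show ?case using *(1,2,4,5) by (meson finite_UnI le_sup_iff)
next
  case FalsumE
  then show ?case by (meson entails.FalsumE)
next
  case ConjE1
  then show ?case by (meson entails.ConjE1)
next
  case ConjE2
  then show ?case by (meson entails.ConjE2)
next
  case DisjI1
  then show ?case by (meson entails.DisjI1)
next
  case DisjI2
  then show ?case by (meson entails.DisjI2)
qed

section \<open>Kripke models\<close>

text \<open>The accessibility relation is only a partial preorder on its type: the worlds of the model are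
  the points related to themselves. So a model may live on a proper subset of a type, such as
  the prime theories among all sets of formulas.\<close>

locale kripke =
  fixes R :: "'w \<Rightarrow> 'w \<Rightarrow> bool" and V :: "'w \<Rightarrow> 'v \<Rightarrow> bool"
  assumes R_trans: "R u v \<Longrightarrow> R v w \<Longrightarrow> R u w"
    and R_refl: "R u v \<Longrightarrow> R v v"
    and V_persistent: "R u v \<Longrightarrow> V u x \<Longrightarrow> V v x"

fun forces :: "('w \<Rightarrow> 'w \<Rightarrow> bool) \<Rightarrow> ('w \<Rightarrow> 'v \<Rightarrow> bool) \<Rightarrow> 'w \<Rightarrow> 'v form \<Rightarrow> bool" where
  "forces R V w (Var x) \<longleftrightarrow> V w x"
| "forces R V w \<^bold>\<bottom> \<longleftrightarrow> False"
| "forces R V w (\<phi> \<^bold>\<and> \<psi>) \<longleftrightarrow> forces R V w \<phi> \<and> forces R V w \<psi>"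
| "forces R V w (\<phi> \<^bold>\<or> \<psi>) \<longleftrightarrow> forces R V w \<phi> \<or> forces R V w \<psi>"
| "forces R V w (\<phi> \<^bold>\<rightarrow> \<psi>) \<longleftrightarrow> (\<forall>v. R w v \<longrightarrow> forces R V v \<phi> \<longrightarrow> forces R V v \<psi>)"

lemma (in kripke) forces_persistent: "R u v \<Longrightarrow> forces R V u \<phi> \<Longrightarrow> forces R V v \<phi>"
  by (induction \<phi>) (auto dest: V_persistent R_trans)

lemma (in kripke) soundness:
  "\<Gamma> \<turnstile> \<phi> \<Longrightarrow> R w w \<Longrightarrow> \<forall>\<gamma>\<in>\<Gamma>. forces R V w \<gamma> \<Longrightarrow> forces R V w \<phi>"
proof (induction arbitrary: w rule: entails.induct)
  case (ImplI \<phi> \<Gamma> \<psi>)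
  show ?case
    using ImplI.IH ImplI.prems(2) by (auto dest: R_refl forces_persistent)
qed auto

section \<open>The canonical model\<close>

definition prime_theory :: "'v form set \<Rightarrow> bool" where
  "prime_theory \<Delta> \<longleftrightarrow> \<^bold>\<bottom> \<notin> \<Delta> \<and> (\<forall>\<phi>. \<Delta> \<turnstile> \<phi> \<longrightarrow> \<phi> \<in> \<Delta>) \<and>
     (\<forall>\<phi> \<psi>. \<phi> \<^bold>\<or> \<psi> \<in> \<Delta> \<longrightarrow> \<phi> \<in> \<Delta> \<or> \<psi> \<in> \<Delta>)"

text \<open>A set that is maximal among those not entailing \<open>\<phi>\<close> is prime, because adding any
  further formula makes \<open>\<phi>\<close> derivable; Zorn's lemma applies since derivations use finitely many
  premises.\<close>

lemma prime_extension:
  assumes "\<not> \<Gamma> \<turnstile> \<phi>"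
  obtains \<Delta> where "\<Gamma> \<subseteq> \<Delta>" "prime_theory \<Delta>" "\<phi> \<notin> \<Delta>"
proof -
  let ?A = "{\<Delta>. \<Gamma> \<subseteq> \<Delta> \<and> \<not> \<Delta> \<turnstile> \<phi>}"
  have "?A \<noteq> {}" using assms by blast
  moreover have "\<Union> C \<in> ?A" if C: "C \<noteq> {}" "subset.chain ?A C" for C
  proof -
    have sub: "C \<subseteq> ?A" using C(2) by (simp add: subset.chain_def)
    have "\<not> \<Union> C \<turnstile> \<phi>"
    proof
      assume "\<Union> C \<turnstile> \<phi>"
      then obtain \<Delta> where "finite \<Delta>" "\<Delta> \<subseteq> \<Union> C" "\<Delta> \<turnstile> \<phi>" using finite_premises by blast
      moreover from this C obtain B where "B \<in> C" "\<Delta> \<subseteq> B"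
        using finite_subset_Union_chain by (metis (no_types, lifting))
      ultimately show False using sub weakening by blast
    qed
    then show ?thesis using sub C(1) by blast
  qed
  ultimately have "\<exists>\<Delta>\<in>?A. \<forall>X\<in>?A. \<Delta> \<subseteq> X \<longrightarrow> X = \<Delta>" by (rule subset_Zorn_nonempty)
  then obtain \<Delta> where \<Delta>: "\<Delta> \<in> ?A" and max: "\<forall>X\<in>?A. \<Delta> \<subseteq> X \<longrightarrow> X = \<Delta>" ..
  have adds: "insert \<psi> \<Delta> \<turnstile> \<phi>" if "\<psi> \<notin> \<Delta>" for \<psi>
    using that \<Delta> max by (metis (mono_tags, lifting) insertI1 mem_Collect_eq subset_insertI subset_trans)
  have closed: "\<psi> \<in> \<Delta>" if "\<Delta> \<turnstile> \<psi>" for \<psi>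
    using cut[OF that] adds \<Delta> by blast
  moreover have "\<^bold>\<bottom> \<notin> \<Delta>" using \<Delta> by (blast intro: Assm FalsumE)
  moreover have "\<psi> \<in> \<Delta> \<or> \<chi> \<in> \<Delta>" if "\<psi> \<^bold>\<or> \<chi> \<in> \<Delta>" for \<psi> \<chi>
    using DisjE[OF Assm[OF that]] adds \<Delta> by blast
  moreover have "\<phi> \<notin> \<Delta>" using \<Delta> by (blast intro: Assm)
  ultimately show thesis using that[of \<Delta>] \<Delta> unfolding prime_theory_def by blast
qed

definition canonical_rel :: "'v form set \<Rightarrow> 'v form set \<Rightarrow> bool" where
  "canonical_rel \<Delta> \<Delta>' \<longleftrightarrow> prime_theory \<Delta> \<and> prime_theory \<Delta>' \<and> \<Delta> \<subseteq> \<Delta>'"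

definition canonical_val :: "'v form set \<Rightarrow> 'v \<Rightarrow> bool" where
  "canonical_val \<Delta> x \<longleftrightarrow> Var x \<in> \<Delta>"

lemma kripke_canonical: "kripke canonical_rel canonical_val"
  by unfold_locales (auto simp: canonical_rel_def canonical_val_def)

lemma forces_canonical:
  "prime_theory \<Delta> \<Longrightarrow> forces canonical_rel canonical_val \<Delta> \<phi> \<longleftrightarrow> \<phi> \<in> \<Delta>"
proof (induction \<phi> arbitrary: \<Delta>)
  case (Conj \<phi> \<psi>)
  have "\<phi> \<^bold>\<and> \<psi> \<in> \<Delta> \<longleftrightarrow> \<phi> \<in> \<Delta> \<and> \<psi> \<in> \<Delta>"
    using Conj.prems unfolding prime_theory_def by (meson Assm ConjI ConjE1 ConjE2)
  then show ?case using Conj by simp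
next
  case (Disj \<phi> \<psi>)
  have "\<phi> \<^bold>\<or> \<psi> \<in> \<Delta> \<longleftrightarrow> \<phi> \<in> \<Delta> \<or> \<psi> \<in> \<Delta>"
    using Disj.prems unfolding prime_theory_def by (meson Assm DisjI1 DisjI2)
  then show ?case using Disj by simp
next
  case (Impl \<phi> \<psi>)
  have "\<phi> \<^bold>\<rightarrow> \<psi> \<in> \<Delta> \<longleftrightarrow> (\<forall>\<Delta>'. prime_theory \<Delta>' \<longrightarrow> \<Delta> \<subseteq> \<Delta>' \<longrightarrow> \<phi> \<in> \<Delta>' \<longrightarrow> \<psi> \<in> \<Delta>')"
  proof
    assume "\<phi> \<^bold>\<rightarrow> \<psi> \<in> \<Delta>"
    then show "\<forall>\<Delta>'. prime_theory \<Delta>' \<longrightarrow> \<Delta> \<subseteq> \<Delta>' \<longrightarrow> \<phi> \<in> \<Delta>' \<longrightarrow> \<psi> \<in> \<Delta>'"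
      unfolding prime_theory_def by (meson Assm ImplE subsetD)
  next
    assume *: "\<forall>\<Delta>'. prime_theory \<Delta>' \<longrightarrow> \<Delta> \<subseteq> \<Delta>' \<longrightarrow> \<phi> \<in> \<Delta>' \<longrightarrow> \<psi> \<in> \<Delta>'"
    have "insert \<phi> \<Delta> \<turnstile> \<psi>"
    proof (rule ccontr)
      assume "\<not> insert \<phi> \<Delta> \<turnstile> \<psi>"
      from prime_extension[OF this] * show False by (metis insert_subset)
    qed
    then have "\<Delta> \<turnstile> \<phi> \<^bold>\<rightarrow> \<psi>" by (rule ImplI)
    then show "\<phi> \<^bold>\<rightarrow> \<psi> \<in> \<Delta>" using Impl.prems by (simp add: prime_theory_def)
  qed
  then show ?case using Impl by (auto simp: canonical_rel_def)
qed (auto simp: canonical_val_def prime_theory_def)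

section \<open>The translation\<close>

text \<open>These formulas from the Rieger-Nishimura lattice define the initial segments of the ladder, so
  that \<open>rung (k + 1)\<close> and \<open>rung k\<close> differ on it exactly at the \<open>k\<close>-th point.\<close>

fun rung :: "nat \<Rightarrow> F2" where
  "rung 0 = \<^bold>\<bottom>"
| "rung (Suc 0) = Var X1"
| "rung (Suc (Suc k)) = rung (Suc k) \<^bold>\<or> (rung (Suc k) \<^bold>\<rightarrow> rung k)"

text \<open>The two rungs in \<open>miss k\<close> select the \<open>k\<close>-th point of the ladder together with its twin, and
  \<open>x\<^sub>2\<close> tells the twin from the rung.\<close>

definition miss :: "nat \<Rightarrow> F2" where
  "miss k = rung (Suc k) \<^bold>\<rightarrow> (rung k \<^bold>\<or> Var X2)"

definition letter :: "nat \<Rightarrow> F2" where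
  "letter i = miss (2 * i) \<^bold>\<or> miss (Suc (2 * i))"

text \<open>The disjunct \<open>letter 0\<close> in the clause for variables makes the stand-in for \<open>\<^bold>\<bottom>\<close> entail
  every translated formula.\<close>

fun tr :: "F\<omega> \<Rightarrow> F2" where
  "tr (Var n) = letter (Suc n) \<^bold>\<or> letter 0"
| "tr \<^bold>\<bottom> = letter 0"
| "tr (\<phi> \<^bold>\<and> \<psi>) = tr \<phi> \<^bold>\<and> tr \<psi>"
| "tr (\<phi> \<^bold>\<or> \<psi>) = tr \<phi> \<^bold>\<or> tr \<psi>"
| "tr (\<phi> \<^bold>\<rightarrow> \<psi>) = tr \<phi> \<^bold>\<rightarrow> tr \<psi>"

lemma tr_ex_falso: "\<Gamma> \<turnstile> letter 0 \<Longrightarrow> \<Gamma> \<turnstile> tr \<phi>"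
proof (induction \<phi> arbitrary: \<Gamma>)
  case (Impl \<phi> \<psi>)
  have "insert (tr \<phi>) \<Gamma> \<turnstile> letter 0" using Impl.prems weakening by blast
  then show ?case using Impl.IH(2) by (auto intro: ImplI)
qed (auto intro: entails.intros)

lemma tr_entails: "\<Gamma> \<turnstile> \<phi> \<Longrightarrow> tr ` \<Gamma> \<turnstile> tr \<phi>"
proof (induction rule: entails.induct)
  case (FalsumE \<Gamma> \<phi>)
  then show ?case using tr_ex_falso by simp
next
  case (DisjE \<Gamma> \<phi> \<psi> \<chi>)
  then show ?case by (auto intro: entails.DisjE)
qed (auto intro: entails.intros)

section \<open>Simulating a model with two variables\<close>

datatype 'w point = World 'w | Side nat | Ladder nat

text \<open>The order of the Rieger-Nishimura ladder: consecutive rungs are incomparable.\<close>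

definition below :: "nat \<Rightarrow> nat \<Rightarrow> bool" where
  "below m n \<longleftrightarrow> n = m \<or> n + 2 \<le> m"

text \<open>Letter \<open>i\<close> fails at an old world exactly if the world is put below both \<open>Side (2 * i)\<close> and
  \<open>Side (2 * i + 1)\<close>. Letter \<open>0\<close> stands for \<open>\<^bold>\<bottom>\<close> and fails at every old world.
  All old worlds see the whole ladder, so that they force no \<open>rung k\<close> and cannot be mistaken for
  side points.\<close>

fun ext_rel :: "('w \<Rightarrow> 'w \<Rightarrow> bool) \<Rightarrow> ('w \<Rightarrow> nat \<Rightarrow> bool) \<Rightarrow> 'w point \<Rightarrow> 'w point \<Rightarrow> bool" where
  "ext_rel R V (World u) (World v) \<longleftrightarrow> R u v"
| "ext_rel R V (World u) (Side k) \<longleftrightarrow> \<not> case_nat False (V u) (k div 2)"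
| "ext_rel R V (World u) (Ladder n) \<longleftrightarrow> True"
| "ext_rel R V (Side k) (Side j) \<longleftrightarrow> j = k"
| "ext_rel R V (Side k) (Ladder n) \<longleftrightarrow> below k n"
| "ext_rel R V (Ladder m) (Ladder n) \<longleftrightarrow> below m n"
| "ext_rel R V _ _ \<longleftrightarrow> False"

fun ext_val :: "'w point \<Rightarrow> two \<Rightarrow> bool" where
  "ext_val (World u) x \<longleftrightarrow> False"
| "ext_val (Side k) x \<longleftrightarrow> x = X1 \<and> k = 0"
| "ext_val (Ladder n) x \<longleftrightarrow> x = X2 \<or> n = 0"

lemma all_point_iff:
  "(\<forall>p. P p) \<longleftrightarrow> (\<forall>w. P (World w)) \<and> (\<forall>k. P (Side k)) \<and> (\<forall>n. P (Ladder n))"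
  by (metis point.exhaust)

lemma kripke_ext:
  assumes "kripke R V"
  shows "kripke (ext_rel R V) ext_val"
proof -
  interpret kripke R V by fact
  show ?thesis
  proof
    fix p q r
    show "ext_rel R V p q \<Longrightarrow> ext_rel R V q r \<Longrightarrow> ext_rel R V p r"
      by (cases p; cases q; cases r)
        (auto simp: below_def split: nat.splits dest: V_persistent intro: R_trans)
  next
    fix p q
    show "ext_rel R V p q \<Longrightarrow> ext_rel R V q q"
      by (cases p; cases q) (auto simp: below_def intro: R_refl)
  next
    fix p q x
    show "ext_rel R V p q \<Longrightarrow> ext_val p x \<Longrightarrow> ext_val q x"
      by (cases p; cases q) (auto simp: below_def)
  qed
qed

text \<open>On the ladder, \<open>rung (k + 1) \<^bold>\<rightarrow> rung k\<close> excludes the points that see \<open>Ladder k\<close>, and the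
  only one of the others that is not among the first \<open>k\<close> points is \<open>Ladder (k + 1)\<close>.\<close>

lemma forces_rung_Ladder: "forces (ext_rel R V) ext_val (Ladder n) (rung k) \<longleftrightarrow> n < k"
proof (induction k arbitrary: n rule: rung.induct)
  case (3 k)
  have "(\<forall>m. below n m \<longrightarrow> m < Suc k \<longrightarrow> m < k) \<longleftrightarrow> n < k \<or> n = Suc k"
    unfolding below_def by presburger
  then show ?case by (simp add: 3 all_point_iff) linarith
qed auto

text \<open>Formulas in \<open>x\<^sub>1\<close> alone cannot separate \<open>Side n\<close> from \<open>Ladder n\<close>: the two agree on
  \<open>x\<^sub>1\<close>, and \<open>Side n\<close> sees the same rungs and no other side point.\<close>

lemma forces_rung_Side: "forces (ext_rel R V) ext_val (Side n) (rung k) \<longleftrightarrow> n < k"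
proof (induction k arbitrary: n rule: rung.induct)
  case (3 k)
  have "(\<forall>m. below n m \<longrightarrow> m < Suc k \<longrightarrow> m < k) \<longleftrightarrow> n < k \<or> n = Suc k"
    unfolding below_def by presburger
  moreover have "below n n" by (simp add: below_def)
  ultimately show ?case by (simp add: 3 all_point_iff forces_rung_Ladder) linarith
qed auto

lemma forces_miss:
  "forces (ext_rel R V) ext_val (Ladder n) (miss k)"
  "forces (ext_rel R V) ext_val (Side n) (miss k) \<longleftrightarrow> n \<noteq> k"
  by (auto simp: miss_def all_point_iff forces_rung_Ladder forces_rung_Side)

text \<open>No translated formula fails at an added point: \<open>Side n\<close> refutes only \<open>miss n\<close>, so it
  forces one disjunct of each letter.\<close>

lemma forces_tr_added:
  "forces (ext_rel R V) ext_val (Ladder n) (tr \<phi>)"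
  "forces (ext_rel R V) ext_val (Side n) (tr \<phi>)"
  by (induction \<phi> arbitrary: n) (auto simp: letter_def forces_miss all_point_iff)

lemma forces_rung_World:
  assumes "kripke R V"
  shows "\<not> forces (ext_rel R V) ext_val (World w) (rung k)"
proof
  interpret E: kripke "ext_rel R V" ext_val using assms by (rule kripke_ext)
  assume "forces (ext_rel R V) ext_val (World w) (rung k)"
  then have "forces (ext_rel R V) ext_val (Ladder k) (rung k)"
    by (rule E.forces_persistent[rotated]) simp
  then show False by (simp add: forces_rung_Ladder)
qed

lemma forces_letter_World:
  assumes "kripke R V"
  shows "forces (ext_rel R V) ext_val (World w) (letter i) \<longleftrightarrow> case_nat False (V w) i"
proof -
  have "forces (ext_rel R V) ext_val (World w) (miss k) \<longleftrightarrow> case_nat False (V w) (k div 2)" for k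
    unfolding miss_def
    by (auto simp: all_point_iff forces_rung_Ladder forces_rung_Side forces_rung_World[OF assms] less_Suc_eq)
  then show ?thesis by (simp add: letter_def)
qed

lemma forces_tr:
  assumes "kripke R V"
  shows "forces (ext_rel R V) ext_val (World w) (tr \<phi>) \<longleftrightarrow> forces R V w \<phi>"
  by (induction \<phi> arbitrary: w)
    (auto simp: forces_letter_World[OF assms] forces_tr_added all_point_iff)

lemma tr_entails_iff: "\<Gamma> \<turnstile> \<phi> \<longleftrightarrow> tr ` \<Gamma> \<turnstile> tr \<phi>"
proof
  show "\<Gamma> \<turnstile> \<phi> \<Longrightarrow> tr ` \<Gamma> \<turnstile> tr \<phi>" by (rule tr_entails)
next
  assume tr: "tr ` \<Gamma> \<turnstile> tr \<phi>"
  show "\<Gamma> \<turnstile> \<phi>"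
  proof (rule ccontr)
    assume "\<not> \<Gamma> \<turnstile> \<phi>"
    then obtain \<Delta> where \<Delta>: "\<Gamma> \<subseteq> \<Delta>" "prime_theory \<Delta>" "\<phi> \<notin> \<Delta>" by (rule prime_extension)
    let ?R = "ext_rel canonical_rel canonical_val"
    interpret E: kripke ?R ext_val using kripke_canonical by (rule kripke_ext)
    have forces: "forces ?R ext_val (World \<Delta>) (tr \<psi>) \<longleftrightarrow> \<psi> \<in> \<Delta>" for \<psi>
      using \<Delta>(2) by (simp add: forces_tr[OF kripke_canonical] forces_canonical)
    have "?R (World \<Delta>) (World \<Delta>)" using \<Delta>(2) by (simp add: canonical_rel_def)
    then have "forces ?R ext_val (World \<Delta>) (tr \<phi>)"
      using \<Delta>(1) by (intro E.soundness[OF tr]) (auto simp: forces)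
    then show False using \<Delta>(3) by (simp add: forces)
  qed
qed

theorem mainTheorem3:
  "\<exists>f :: F\<omega> \<Rightarrow> F2.
     consequence_respecting f \<and> tautology_respecting f \<and> conj_disj_preserving f"
proof (intro exI conjI)
  show "consequence_respecting tr"
    unfolding consequence_respecting_def using tr_entails_iff by blast
  show "tautology_respecting tr"
    unfolding tautology_respecting_def using tr_entails_iff[of "{}"] by simp
  show "conj_disj_preserving tr"
    by (simp add: conj_disj_preserving_def)
qed

end
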